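(* Let $0\le|\beta|<\alpha$, $\mu\in\mathbb{R}$ and let $X\sim\mathrm{AL}(\alpha,\beta,\mu)$. Then $$\mathbb{E}\big[|X-\mathbb{E}[X]|\big]=\frac{\alpha+|\beta|}{\alpha(\alpha-|\beta|)}\exp\bigg\{-\frac{2|\beta|}{\alpha+|\beta|}\bigg\}.$$
   Context: $\mathrm{AL}(\alpha,\beta,\mu)$ denotes the asymmetric Laplace distribution, with probability density function $p(x)=\frac{\alpha^2-\beta^2}{2\alpha}\,\mathrm{e}^{\beta(x-\mu)-\alpha|x-\mu|}$, $x\in\mathbb{R}$. *)

theory Defs
  imports "HOL-Probability.Probability"
begin

definition asym_laplace_density :: "real \<Rightarrow> real \<Rightarrow> real \<Rightarrow> real \<Rightarrow> real" where
  "asym_laplace_density \<alpha> \<beta> \<mu> x =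
     (\<alpha>\<^sup>2 - \<beta>\<^sup>2) / (2 * \<alpha>) * exp (\<beta> * (x - \<mu>) - \<alpha> * \<bar>x - \<mu>\<bar>)"

end

theory Submission
  imports Defs "HOL-Real_Asymp.Real_Asymp"
begin

text \<open>
  Since \<open>X - E X\<close> has mean zero, \<open>E \<bar>X - E X\<bar> = 2 E (X - E X)\<^sup>+\<close>. For \<open>\<beta> \<ge> 0\<close> the mean
  \<open>\<mu> + 2 \<beta> / (\<alpha>\<^sup>2 - \<beta>\<^sup>2)\<close> lies to the right of \<open>\<mu>\<close>, where the density is a single exponential, so
  only the elementary integral of \<open>(x - c) exp (- (\<alpha> - \<beta>) (x - \<mu>))\<close> over \<open>x \<ge> c\<close> is needed.
  The case \<open>\<beta> < 0\<close> follows by reflection, as \<open>- X\<close> is distributed as \<open>AL(\<alpha>, - \<beta>, - \<mu>)\<close>.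
\<close>

text \<open>The integrand is nonnegative on the half-line and has an elementary antiderivative. The
  offset \<open>t\<close> is kept apart from the cut point \<open>c\<close> because the density is
  centred at \<mu> while the cut may lie further right.\<close>

lemma nn_integral_linear_exp_tail:
  fixes a c t :: real
  assumes a: "0 < a"
  shows "(\<integral>\<^sup>+x. ennreal ((x - c) * exp (- a * (x - t))) * indicator {c..} x \<partial>lborel) =
    ennreal (exp (- a * (c - t)) / a\<^sup>2)"
proof -
  \<comment> \<open>This antiderivative comes from integration by parts. It vanishes at infinity and
    its linear term vanishes at \<open>c\<close>, so only the \<open>1 / a\<^sup>2\<close> term
    survives.\<close>
  define F where "F x = - ((x - c) / a + 1 / a\<^sup>2) * exp (- a * (x - t))" for x
  have "(F \<longlongrightarrow> 0) at_top"
    unfolding F_def using a by real_asymp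
  moreover have "DERIV F x :> (x - c) * exp (- a * (x - t))" for x
    unfolding F_def using a
    by (auto intro!: derivative_eq_intros simp: field_simps power2_eq_square)
  ultimately have "(\<integral>\<^sup>+x. ennreal ((x - c) * exp (- a * (x - t))) * indicator {c..} x \<partial>lborel) =
      ennreal (0 - F c)"
    by (intro nn_integral_FTC_atLeast) auto
  then show ?thesis
    by (simp add: F_def)
qed

text \<open>Serves twice: with \<open>c\<close> = \<mu> to compute the mean, and with
  \<open>c\<close> the mean itself to compute the deviation. Both signs of \<beta> are allowed so
  that it also applies to the reflected variable.\<close>

lemma (in prob_space) asym_laplace_positive_part:
  assumes \<beta>: "\<bar>\<beta>\<bar> < \<alpha>" and c: "\<mu> \<le> c"
    and X: "distributed M lborel X (\<lambda>x. ennreal (asym_laplace_density \<alpha> \<beta> \<mu> x))"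
  shows "has_bochner_integral M (\<lambda>\<omega>. max 0 (X \<omega> - c))
    ((\<alpha> + \<beta>) / (2 * \<alpha> * (\<alpha> - \<beta>)) * exp (- (\<alpha> - \<beta>) * (c - \<mu>)))"
proof (rule has_bochner_integral_nn_integral)
  define K where "K = (\<alpha>\<^sup>2 - \<beta>\<^sup>2) / (2 * \<alpha>)"
  have pos: "0 < \<alpha> - \<beta>" "0 < \<alpha> + \<beta>" "0 < \<alpha>"
    using \<beta> by linarith+
  have K_eq: "K = (\<alpha> - \<beta>) * (\<alpha> + \<beta>) / (2 * \<alpha>)"
    by (simp add: K_def power2_eq_square algebra_simps)
  have K: "0 \<le> K"
    using pos by (simp add: K_eq)
  show "(\<lambda>\<omega>. max 0 (X \<omega> - c)) \<in> borel_measurable M"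
    using distributed_measurable[OF X] by simp
  show "0 \<le> (\<alpha> + \<beta>) / (2 * \<alpha> * (\<alpha> - \<beta>)) * exp (- (\<alpha> - \<beta>) * (c - \<mu>))"
    using pos by simp
  have density: "asym_laplace_density \<alpha> \<beta> \<mu> x = K * exp (- (\<alpha> - \<beta>) * (x - \<mu>))" if "c \<le> x" for x
  proof -
    have "\<bar>x - \<mu>\<bar> = x - \<mu>"
      using that c by simp
    then show ?thesis
      by (simp add: asym_laplace_density_def K_def algebra_simps)
  qed
  have "(\<integral>\<^sup>+\<omega>. ennreal (max 0 (X \<omega> - c)) \<partial>M) =
      (\<integral>\<^sup>+x. ennreal (asym_laplace_density \<alpha> \<beta> \<mu> x) * ennreal (max 0 (x - c)) \<partial>lborel)"
    by (rule distributed_nn_integral[OF X, symmetric]) simp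
  also have "\<dots> = (\<integral>\<^sup>+x. ennreal K *
      (ennreal ((x - c) * exp (- (\<alpha> - \<beta>) * (x - \<mu>))) * indicator {c..} x) \<partial>lborel)"
    \<comment> \<open>For \<open>x < c\<close> both integrands are zero, so \<open>density\<close>
      is only needed on the half-line where it holds.\<close>
    using K by (intro nn_integral_cong)
      (auto simp: density max_def ennreal_mult'[symmetric] ennreal_mult''[symmetric] mult_ac
         split: split_indicator)
  also have "\<dots> = ennreal K * ennreal (exp (- (\<alpha> - \<beta>) * (c - \<mu>)) / (\<alpha> - \<beta>)\<^sup>2)"
    by (subst nn_integral_cmult) (simp_all only: nn_integral_linear_exp_tail[OF pos(1)], simp)
  also have "\<dots> = ennreal (K * (exp (- (\<alpha> - \<beta>) * (c - \<mu>)) / (\<alpha> - \<beta>)\<^sup>2))"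
    using K by (rule ennreal_mult'[symmetric])
  also have "K * (exp (- (\<alpha> - \<beta>) * (c - \<mu>)) / (\<alpha> - \<beta>)\<^sup>2) =
      (\<alpha> + \<beta>) / (2 * \<alpha> * (\<alpha> - \<beta>)) * exp (- (\<alpha> - \<beta>) * (c - \<mu>))"
    using pos by (simp add: K_eq power2_eq_square)
  finally show "(\<integral>\<^sup>+\<omega>. ennreal (max 0 (X \<omega> - c)) \<partial>M) =
      ennreal ((\<alpha> + \<beta>) / (2 * \<alpha> * (\<alpha> - \<beta>)) * exp (- (\<alpha> - \<beta>) * (c - \<mu>)))" .
qed simp

lemma (in prob_space) asym_laplace_uminus:
  assumes X: "distributed M lborel X (\<lambda>x. ennreal (asym_laplace_density \<alpha> \<beta> \<mu> x))"
  shows "distributed M lborel (\<lambda>\<omega>. - X \<omega>)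
    (\<lambda>x. ennreal (asym_laplace_density \<alpha> (- \<beta>) (- \<mu>) x))"
proof -
  have "asym_laplace_density \<alpha> \<beta> \<mu> (- x) = asym_laplace_density \<alpha> (- \<beta>) (- \<mu>) x" for x
  proof -
    have "\<bar>- x - \<mu>\<bar> = \<bar>x - - \<mu>\<bar>" and "\<beta> * (- x - \<mu>) = - \<beta> * (x - - \<mu>)"
      by (simp_all add: algebra_simps)
    then show ?thesis
      unfolding asym_laplace_density_def by simp
  qed
  then show ?thesis
    using distributed_affine[OF X, of "-1" 0] by (simp add: divide_ennreal_def)
qed

text \<open>\<open>X\<close> is \<mu> plus the positive part minus the negative part of
  \<open>X - \<mu>\<close>. Each part is integrable with a known integral, which yields
  integrability of \<open>X\<close> along with its mean.\<close>

lemma (in prob_space) asym_laplace_expectation: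
  assumes \<beta>: "\<bar>\<beta>\<bar> < \<alpha>"
    and X: "distributed M lborel X (\<lambda>x. ennreal (asym_laplace_density \<alpha> \<beta> \<mu> x))"
  shows "has_bochner_integral M X (\<mu> + 2 * \<beta> / (\<alpha>\<^sup>2 - \<beta>\<^sup>2))"
proof -
  have pos: "0 < \<alpha> - \<beta>" "0 < \<alpha> + \<beta>" "0 < \<alpha>"
    using \<beta> by linarith+
  have right: "has_bochner_integral M (\<lambda>\<omega>. max 0 (X \<omega> - \<mu>)) ((\<alpha> + \<beta>) / (2 * \<alpha> * (\<alpha> - \<beta>)))"
    using asym_laplace_positive_part[OF \<beta> order_refl X] by simp
  \<comment> \<open>The negative part of \<open>X - \<mu>\<close> is the positive part of
    \<open>- X\<close> beyond its own location parameter \<open>- \<mu>\<close>, so reflection swaps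
    \<beta> for \<open>- \<beta>\<close> in the formula.\<close>
  have left: "has_bochner_integral M (\<lambda>\<omega>. max 0 (- X \<omega> + \<mu>)) ((\<alpha> - \<beta>) / (2 * \<alpha> * (\<alpha> + \<beta>)))"
    using asym_laplace_positive_part[OF _ order_refl asym_laplace_uminus[OF X]] \<beta> by simp
  have "has_bochner_integral M (\<lambda>\<omega>. \<mu>) \<mu>"
    using has_bochner_integral_iff[of M "\<lambda>\<omega>. \<mu>" \<mu>] by (simp add: prob_space)
  from has_bochner_integral_add[OF this has_bochner_integral_diff[OF right left]]
  have "has_bochner_integral M (\<lambda>\<omega>. \<mu> + (max 0 (X \<omega> - \<mu>) - max 0 (- X \<omega> + \<mu>)))
    (\<mu> + ((\<alpha> + \<beta>) / (2 * \<alpha> * (\<alpha> - \<beta>)) - (\<alpha> - \<beta>) / (2 * \<alpha> * (\<alpha> + \<beta>))))" .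
  moreover have "(\<lambda>\<omega>. \<mu> + (max 0 (X \<omega> - \<mu>) - max 0 (- X \<omega> + \<mu>))) = X"
    by (auto simp: max_def)
  moreover have "(\<alpha> + \<beta>) / (2 * \<alpha> * (\<alpha> - \<beta>)) - (\<alpha> - \<beta>) / (2 * \<alpha> * (\<alpha> + \<beta>)) =
      2 * \<beta> / (\<alpha>\<^sup>2 - \<beta>\<^sup>2)"
  proof -
    have "\<alpha>\<^sup>2 - \<beta>\<^sup>2 = (\<alpha> - \<beta>) * (\<alpha> + \<beta>)"
      by (simp add: power2_eq_square algebra_simps)
    then show ?thesis
      using pos by (simp add: divide_simps) (simp add: algebra_simps)
  qed
  ultimately show ?thesis
    by simp
qed

lemma (in prob_space) asym_laplace_mean_deviation_nonneg:
  assumes \<beta>: "0 \<le> \<beta>" "\<beta> < \<alpha>"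
    and X: "distributed M lborel X (\<lambda>x. ennreal (asym_laplace_density \<alpha> \<beta> \<mu> x))"
  shows "expectation (\<lambda>\<omega>. \<bar>X \<omega> - expectation X\<bar>) =
    (\<alpha> + \<beta>) / (\<alpha> * (\<alpha> - \<beta>)) * exp (- (2 * \<beta> / (\<alpha> + \<beta>)))"
proof -
  define c where "c = expectation X"
  have abs_\<beta>: "\<bar>\<beta>\<bar> < \<alpha>"
    using \<beta> by simp
  have factor: "\<alpha>\<^sup>2 - \<beta>\<^sup>2 = (\<alpha> - \<beta>) * (\<alpha> + \<beta>)"
    by (simp add: power2_eq_square algebra_simps)
  have int_X: "integrable M X" and c_eq: "c = \<mu> + 2 * \<beta> / (\<alpha>\<^sup>2 - \<beta>\<^sup>2)"
    using asym_laplace_expectation[OF abs_\<beta> X] by (auto simp: has_bochner_integral_iff c_def)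
  \<comment> \<open>The sign of \<beta> puts the mean on the side of \<mu> covered by
    \<open>asym_laplace_positive_part\<close>.\<close>
  have "\<mu> \<le> c"
    using \<beta> by (simp add: c_eq factor)
  note pos_part = asym_laplace_positive_part[OF abs_\<beta> this X, unfolded has_bochner_integral_iff]
  have "expectation (\<lambda>\<omega>. \<bar>X \<omega> - c\<bar>) = expectation (\<lambda>\<omega>. 2 * max 0 (X \<omega> - c) - (X \<omega> - c))"
    by (intro Bochner_Integration.integral_cong) (auto simp: max_def)
  also have "\<dots> = 2 * expectation (\<lambda>\<omega>. max 0 (X \<omega> - c)) - (expectation X - c)"
    using int_X pos_part by (simp add: prob_space)
  also have "\<dots> = (\<alpha> + \<beta>) / (\<alpha> * (\<alpha> - \<beta>)) * exp (- (\<alpha> - \<beta>) * (c - \<mu>))"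
    using pos_part by (simp add: c_def)
  \<comment> \<open>The factor \<open>\<alpha> - \<beta>\<close> cancels against the factorised
    denominator of \<open>c - \<mu>\<close>.\<close>
  also have "- (\<alpha> - \<beta>) * (c - \<mu>) = - (2 * \<beta> / (\<alpha> + \<beta>))"
  proof -
    have "\<alpha> - \<beta> \<noteq> 0" "\<alpha> + \<beta> \<noteq> 0"
      using \<beta> by simp_all
    then show ?thesis
      unfolding c_eq factor by (simp add: divide_simps) (simp add: algebra_simps)
  qed
  finally show ?thesis
    by (simp add: c_def)
qed

theorem mainTheorem8:
  fixes M :: "'a measure" and X :: "'a \<Rightarrow> real" and \<alpha> \<beta> \<mu> :: real
  assumes "prob_space M"
    and "0 \<le> \<bar>\<beta>\<bar>" and "\<bar>\<beta>\<bar> < \<alpha>"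
    and "distributed M lborel X (\<lambda>x. ennreal (asym_laplace_density \<alpha> \<beta> \<mu> x))"
  shows "prob_space.expectation M (\<lambda>\<omega>. \<bar>X \<omega> - prob_space.expectation M X\<bar>) =
           (\<alpha> + \<bar>\<beta>\<bar>) / (\<alpha> * (\<alpha> - \<bar>\<beta>\<bar>)) * exp (- (2 * \<bar>\<beta>\<bar> / (\<alpha> + \<bar>\<beta>\<bar>)))"
proof -
  interpret prob_space M
    by fact
  show ?thesis
  proof (cases "0 \<le> \<beta>")
    case True
    then show ?thesis
      using asym_laplace_mean_deviation_nonneg[OF _ _ assms(4)] assms(3) by simp
  next
    case False
    \<comment> \<open>The mean deviation is invariant under reflection, and the reflected parameter
      \<open>- \<beta>\<close> equals \<open>\<bar>\<beta>\<bar>\<close> here.\<close>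
    have "\<bar>- X \<omega> - expectation (\<lambda>\<omega>. - X \<omega>)\<bar> = \<bar>X \<omega> - expectation X\<bar>" for \<omega>
      by simp
    then show ?thesis
      using asym_laplace_mean_deviation_nonneg[OF _ _ asym_laplace_uminus[OF assms(4)]]
        False assms(3) by simp
  qed
qed

end
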